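(* Let $\Omega\subset\mathbb{R}^N$ be a bounded domain, $k\in\{1,\dots,N\}$, and let $u\in C^2(\Omega)\cap L^\infty(\mathbb{R}^N)$. Consider the maps $$\Psi:(x,\xi)\in\Omega\times\mathcal{S}^{N-1}\mapsto \mathcal{I}_\xi u(x),\qquad \mathcal{I}^\pm_k u:x\in\Omega\mapsto\mathcal{I}^\pm_k u(x).$$ If $u\in LSC(\mathbb{R}^N)$ (respectively $u\in USC(\mathbb{R}^N)$, $u\in C(\mathbb{R}^N)$), then (i) $\Psi\in LSC(\Omega\times\mathcal{S}^{N-1})$ (respectively $\Psi\in USC(\Omega\times\mathcal{S}^{N-1})$, $\Psi\in C(\Omega\times\mathcal{S}^{N-1})$); (ii) $\mathcal{I}^\pm_k u\in LSC(\Omega)$ (respectively $\mathcal{I}^\pm_k u\in USC(\Omega)$, $\mathcal{I}^\pm_k u\in C(\Omega)$), for both choices of sign.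
   Context: Fix $s\in(0,1)$. $\mathcal{S}^{N-1}$ is the unit sphere of $\mathbb{R}^N$; $LSC$ and $USC$ denote lower and upper semicontinuous functions. Functions in $L^\infty(\mathbb{R}^N)$ are bounded measurable functions defined at every point. Set $\delta(u,x,y)=u(x+y)+u(x-y)-2u(x)$, and for $\xi\in\mathcal{S}^{N-1}$ $$\mathcal{I}_\xi u(x)=C_s\int_0^{+\infty}\frac{\delta(u,x,\tau\xi)}{\tau^{1+2s}}\,d\tau,$$ where $C_s=C_{1,s}>0$ is the normalizing constant of the one-dimensional fractional Laplacian. $\mathcal{V}_k$ is the family of $k$-dimensional orthonormal sets $\{\xi_1,\dots,\xi_k\}$ in $\mathbb{R}^N$, and $$\mathcal{I}_k^+u(x)=\sup_{\{\xi_i\}\in\mathcal{V}_k}\sum_{i=1}^k\mathcal{I}_{\xi_i}u(x),\qquad \mathcal{I}_k^-u(x)=\inf_{\{\xi_i\}\in\mathcal{V}_k}\sum_{i=1}^k\mathcal{I}_{\xi_i}u(x).$$ *)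

theory Defs
  imports "HOL-Analysis.Analysis"
begin

definition lsc_on :: "'a::topological_space set \<Rightarrow> ('a \<Rightarrow> real) \<Rightarrow> bool" where
  "lsc_on S f \<longleftrightarrow> (\<forall>x\<in>S. \<forall>a < f x. eventually (\<lambda>y. a < f y) (at x within S))"

definition usc_on :: "'a::topological_space set \<Rightarrow> ('a \<Rightarrow> real) \<Rightarrow> bool" where
  "usc_on S f \<longleftrightarrow> (\<forall>x\<in>S. \<forall>a > f x. eventually (\<lambda>y. f y < a) (at x within S))"

text \<open>In the next definition \<open>g\<close> is the gradient and \<open>H\<close> the Hessian matrix of \<open>u\<close>;
  the continuity of \<open>u\<close> and \<open>g\<close> is implied by their differentiability.\<close>

definition C2_on :: "(real^'n) set \<Rightarrow> (real^'n \<Rightarrow> real) \<Rightarrow> bool" where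
  "C2_on \<Omega> u \<longleftrightarrow>
     (\<exists>(g :: real^'n \<Rightarrow> real^'n) (H :: real^'n \<Rightarrow> real^'n^'n).
        (\<forall>x\<in>\<Omega>. (u has_derivative (\<lambda>h. g x \<bullet> h)) (at x)) \<and>
        (\<forall>x\<in>\<Omega>. (g has_derivative (\<lambda>h. H x *v h)) (at x)) \<and>
        continuous_on \<Omega> H)"

text \<open>Functions defined at every point, not equivalence classes modulo null sets.\<close>

definition bounded_measurable :: "(real^'n \<Rightarrow> real) \<Rightarrow> bool" where
  "bounded_measurable u \<longleftrightarrow> u \<in> borel_measurable lebesgue \<and> bounded (range u)"

text \<open>The normalizing constant \<open>C\<^sub>1\<^sub>,\<^sub>s\<close> for which \<open>- C\<^sub>1\<^sub>,\<^sub>s / 2\<close> times the integral over the real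
  line of \<open>(v (x + t) + v (x - t) - 2 v x) / \<bar>t\<bar> powr (1 + 2 s)\<close> has Fourier symbol
  \<open>\<bar>\<xi>\<bar> powr (2 s)\<close>.\<close>

definition frac_lap_const :: "real \<Rightarrow> real" where
  "frac_lap_const s = inverse (LBINT t:UNIV. (1 - cos t) / \<bar>t\<bar> powr (1 + 2 * s))"

definition second_diff :: "(real^'n \<Rightarrow> real) \<Rightarrow> real^'n \<Rightarrow> real^'n \<Rightarrow> real" where
  "second_diff u x y = u (x + y) + u (x - y) - 2 * u x"

definition I_dir :: "real \<Rightarrow> real^'n \<Rightarrow> (real^'n \<Rightarrow> real) \<Rightarrow> real^'n \<Rightarrow> real" where
  "I_dir s \<xi> u x =
     frac_lap_const s * (LBINT \<tau>:{0<..}. second_diff u x (\<tau> *\<^sub>R \<xi>) / \<tau> powr (1 + 2 * s))"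

definition orthonormal_sets :: "nat \<Rightarrow> (real^'n) set set" where
  "orthonormal_sets k =
     {B. finite B \<and> card B = k \<and> pairwise orthogonal B \<and> (\<forall>\<xi>\<in>B. norm \<xi> = 1)}"

text \<open>The supremum and infimum are taken in the reals.  For \<open>u\<close> bounded and measurable along lines
  and \<open>C\<^sup>2\<close> near \<open>x\<close>, the integrals \<open>I_dir s \<xi> u x\<close> converge absolutely and are bounded
  uniformly in \<open>\<xi>\<close>; if also \<open>1 \<le> k \<le> N\<close>, the families below are nonempty and bounded, so no
  default value is involved.\<close>

definition I_plus :: "nat \<Rightarrow> real \<Rightarrow> (real^'n \<Rightarrow> real) \<Rightarrow> real^'n \<Rightarrow> real" where
  "I_plus k s u x = (SUP B\<in>orthonormal_sets k. \<Sum>\<xi>\<in>B. I_dir s \<xi> u x)"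

definition I_minus :: "nat \<Rightarrow> real \<Rightarrow> (real^'n \<Rightarrow> real) \<Rightarrow> real^'n \<Rightarrow> real" where
  "I_minus k s u x = (INF B\<in>orthonormal_sets k. \<Sum>\<xi>\<in>B. I_dir s \<xi> u x)"

end

theory Submission
  imports Defs
begin

text \<open>Near a point of \<open>\<Omega>\<close> the second differences are \<open>O(\<tau>\<^sup>2)\<close> uniformly in the direction, and they
  are bounded for large \<open>\<tau>\<close>; so the integrands have a common integrable majorant, and Fatou's lemma
  gives lower semicontinuity of \<open>\<Psi>\<close>, as \<open>u\<close> is continuous in \<open>\<Omega>\<close> and hence the term \<open>- 2 u(x)\<close> does
  no harm.  A supremum of lower semicontinuous functions is lower semicontinuous, and so is an
  infimum over a compact parameter set, here the orthonormal \<open>k\<close>-frames.  The upper semicontinuous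
  case is the lower one for \<open>- u\<close>, which exchanges \<open>\<I>\<^sub>k\<^sup>+\<close> and \<open>\<I>\<^sub>k\<^sup>-\<close>.\<close>

section \<open>Semicontinuous functions: calculus, measurability and integration\<close>

text \<open>First countability lets sequences test the filter \<open>at x within S\<close>; this is
  how a statement about sequences of integrals, such as Fatou's lemma, reaches
  \<open>lsc_on\<close>.\<close>

lemma lsc_on_sequentially:
  fixes f :: "'a::first_countable_topology \<Rightarrow> real"
  assumes "\<And>x X a. x \<in> S \<Longrightarrow> (\<And>n. X n \<in> S) \<Longrightarrow> X \<longlonglongrightarrow> x \<Longrightarrow> a < f x
             \<Longrightarrow> eventually (\<lambda>n. a < f (X n)) sequentially"
  shows "lsc_on S f"
  unfolding lsc_on_def
  by (intro ballI allI impI sequentially_imp_eventually_within) (use assms in blast)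

text \<open>The filter \<open>at x within S\<close> is punctured, whereas \<open>X\<close> may take
  the value \<open>x\<close>; at that point the bound is the assumption
  \<open>a < f x\<close>.\<close>

lemma lsc_onD_filter:
  fixes f :: "'a::topological_space \<Rightarrow> real"
  assumes f: "lsc_on S f" and "x \<in> S" and X: "(X \<longlongrightarrow> x) F"
    and XS: "eventually (\<lambda>n. X n \<in> S) F" and "a < f x"
  shows "eventually (\<lambda>n. a < f (X n)) F"
proof -
  have "eventually (\<lambda>y. a < f y) (at x within S)"
    using assms unfolding lsc_on_def by blast
  then have "eventually (\<lambda>y. y \<noteq> x \<longrightarrow> y \<in> S \<longrightarrow> a < f y) (nhds x)"
    by (simp add: eventually_at_filter)
  then have "eventually (\<lambda>y. y \<in> S \<longrightarrow> a < f y) (nhds x)"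
    by eventually_elim (use \<open>a < f x\<close> in blast)
  with X have "eventually (\<lambda>n. X n \<in> S \<longrightarrow> a < f (X n)) F"
    unfolding filterlim_iff by blast
  with XS show ?thesis
    by eventually_elim simp
qed

lemma lsc_on_compose:
  fixes f :: "'b::topological_space \<Rightarrow> real" and h :: "'a::topological_space \<Rightarrow> 'b"
  assumes "lsc_on T f" "continuous_on S h" "h ` S \<subseteq> T"
  shows "lsc_on S (\<lambda>x. f (h x))"
  unfolding lsc_on_def
proof (intro ballI allI impI)
  fix x a assume "x \<in> S" "a < f (h x)"
  then show "eventually (\<lambda>y. a < f (h y)) (at x within S)"
    using assms
    by (intro lsc_onD_filter[OF assms(1), of "h x"])
       (auto simp: continuous_on_def eventually_at_filter image_subset_iff)
qed

lemma lsc_on_add: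
  fixes f g :: "'a::topological_space \<Rightarrow> real"
  assumes "lsc_on S f" "lsc_on S g"
  shows "lsc_on S (\<lambda>x. f x + g x)"
  unfolding lsc_on_def
proof (intro ballI allI impI)
  fix x a assume x: "x \<in> S" and a: "a < f x + g x"
  define e where "e = (f x + g x - a) / 2"
  have e: "e > 0" using a by (simp add: e_def)
  have "eventually (\<lambda>y. f x - e < f y) (at x within S)"
    "eventually (\<lambda>y. g x - e < g y) (at x within S)"
    using assms x e unfolding lsc_on_def by auto
  then show "eventually (\<lambda>y. a < f y + g y) (at x within S)"
    by eventually_elim (simp add: e_def field_simps)
qed

lemma lsc_on_sum:
  fixes f :: "'i \<Rightarrow> 'a::topological_space \<Rightarrow> real"
  assumes "\<And>i. i \<in> I \<Longrightarrow> lsc_on S (f i)"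
  shows "lsc_on S (\<lambda>x. \<Sum>i\<in>I. f i x)"
  using assms
proof (induction I rule: infinite_finite_induct)
  case (insert i I)
  then show ?case by (simp add: lsc_on_add)
qed (auto simp: lsc_on_def)

lemma lsc_on_mult_left:
  fixes f :: "'a::topological_space \<Rightarrow> real"
  assumes "lsc_on S f" "0 \<le> c"
  shows "lsc_on S (\<lambda>x. c * f x)"
proof (cases "c = 0")
  case False
  with assms(2) have c: "c > 0" by simp
  then have "a < c * z \<longleftrightarrow> a / c < z" for a z
    by (simp add: field_simps)
  with assms(1) show ?thesis
    by (simp add: lsc_on_def)
qed (simp add: lsc_on_def)

lemma usc_on_iff_lsc_on_minus: "usc_on S f \<longleftrightarrow> lsc_on S (\<lambda>x. - f x)"
proof -
  have "(\<forall>a > c. P a) \<longleftrightarrow> (\<forall>a < - c. P (- a))" for c :: real and P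
  proof safe
    fix a assume *: "\<forall>a < - c. P (- a)" and "c < a"
    show "P a" using *[rule_format, of "- a"] \<open>c < a\<close> by simp
  qed auto
  moreover have "f y < - a \<longleftrightarrow> a < - f y" for y a
    by (rule less_minus_iff)
  ultimately show ?thesis
    unfolding usc_on_def lsc_on_def by presburger
qed

lemma continuous_on_iff_lsc_on_usc_on:
  fixes f :: "'a::topological_space \<Rightarrow> real"
  shows "continuous_on S f \<longleftrightarrow> lsc_on S f \<and> usc_on S f"
  unfolding continuous_on_def order_tendsto_iff lsc_on_def usc_on_def by blast

text \<open>Strict superlevel sets are open.\<close>

lemma lsc_on_UNIV_borel_measurable:
  fixes f :: "'a::topological_space \<Rightarrow> real"
  assumes "lsc_on UNIV f"
  shows "f \<in> borel_measurable borel"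
proof -
  have "open {x. a < f x}" for a
  proof (subst open_subopen, intro ballI)
    fix x assume "x \<in> {x. a < f x}"
    then have "eventually (\<lambda>y. a < f y) (nhds x)"
      by (intro lsc_onD_filter[OF assms, of x]) (auto simp: filterlim_ident)
    then show "\<exists>T. open T \<and> x \<in> T \<and> T \<subseteq> {x. a < f x}"
      unfolding eventually_nhds by blast
  qed
  then show ?thesis
    by (simp add: borel_measurable_iff_greater)
qed

text \<open>Inserting \<open>min (f n) f\<close>, which converges to \<open>f\<close>, reduces Fatou's lemma to dominated
  convergence.\<close>

lemma integral_lsc_dominated:
  fixes f :: "'a \<Rightarrow> real" and F :: "nat \<Rightarrow> 'a \<Rightarrow> real"
  assumes F: "\<And>n. F n \<in> borel_measurable M" and f: "f \<in> borel_measurable M"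
    and g: "integrable M g"
    and Fg: "\<And>n x. \<bar>F n x\<bar> \<le> g x" and fg: "\<And>x. \<bar>f x\<bar> \<le> g x"
    and lsc: "\<And>x b. b < f x \<Longrightarrow> eventually (\<lambda>n. b < F n x) sequentially"
    and a: "a < integral\<^sup>L M f"
  shows "eventually (\<lambda>n. a < integral\<^sup>L M (F n)) sequentially"
proof -
  have lim: "(\<lambda>n. min (F n x) (f x)) \<longlonglongrightarrow> f x" for x
  proof (rule order_tendstoI)
    fix b assume "b < f x"
    with lsc[OF this] show "eventually (\<lambda>n. b < min (F n x) (f x)) sequentially"
      by (auto elim: eventually_mono)
  qed (auto simp: min_less_iff_disj)
  have bound: "\<bar>min (F n x) (f x)\<bar> \<le> g x" for n x
    using Fg[of n x] fg[of x] by (simp add: min_def)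
  have "(\<lambda>n. \<integral>x. min (F n x) (f x) \<partial>M) \<longlonglongrightarrow> integral\<^sup>L M f"
    by (rule integral_dominated_convergence[where w = g]) (use F f g lim bound in auto)
  then have "eventually (\<lambda>n. a < (\<integral>x. min (F n x) (f x) \<partial>M)) sequentially"
    using a by (rule order_tendstoD)
  then show ?thesis
  proof eventually_elim
    case (elim n)
    \<comment> \<open>A divergent Bochner integral is 0, so both functions must be integrable before
      \<open>min (F n x) (f x) \<le> F n x\<close> can be integrated.\<close>
    have int: "integrable M (F n)"
      by (rule Bochner_Integration.integrable_bound[OF g F]) (auto intro: order_trans[OF Fg abs_ge_self])
    have "integrable M (\<lambda>x. min (F n x) (f x))"
      by (rule Bochner_Integration.integrable_bound[OF g]) (use F f in \<open>auto intro: order_trans[OF bound abs_ge_self]\<close>)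
    with int have "(\<integral>x. min (F n x) (f x) \<partial>M) \<le> integral\<^sup>L M (F n)"
      by (intro integral_mono) auto
    with elim show ?case by simp
  qed
qed

section \<open>Majorants for the integrands near a point of \<Omega>\<close>

text \<open>First-order terms cancel in a symmetric difference. Boundedness of the Hessian on a
  compact ball makes the gradient Lipschitz, so
  \<open>u (x + t *\<^sub>R \<xi>) + u (x - t *\<^sub>R \<xi>)\<close> has a derivative in
  \<open>t\<close> of size O(t), and the mean value inequality gives the quadratic bound.\<close>

lemma C2_on_second_diff_bound:
  fixes u :: "real^'n \<Rightarrow> real"
  assumes \<Omega>: "open \<Omega>" and C2: "C2_on \<Omega> u" and x0: "x0 \<in> \<Omega>"
  obtains r K where "r > 0" "K \<ge> 0" "ball x0 r \<subseteq> \<Omega>"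
    "\<And>x \<xi> \<tau>. x \<in> ball x0 r \<Longrightarrow> norm \<xi> = 1 \<Longrightarrow> 0 < \<tau> \<Longrightarrow> \<tau> < r
       \<Longrightarrow> \<bar>second_diff u x (\<tau> *\<^sub>R \<xi>)\<bar> \<le> K * \<tau>\<^sup>2"
proof -
  obtain g H where u: "\<And>x. x \<in> \<Omega> \<Longrightarrow> (u has_derivative (\<lambda>h. g x \<bullet> h)) (at x)"
    and g: "\<And>x. x \<in> \<Omega> \<Longrightarrow> (g has_derivative (\<lambda>h. H x *v h)) (at x)"
    and H: "continuous_on \<Omega> H"
    using C2 unfolding C2_on_def by blast
  obtain R where R: "R > 0" "cball x0 R \<subseteq> \<Omega>"
    using \<Omega> x0 open_contains_cball by blast
  have "compact (H ` cball x0 R)"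
    using H R by (intro compact_continuous_image continuous_on_subset[OF H]) auto
  then obtain L where L: "\<And>x. x \<in> cball x0 R \<Longrightarrow> norm (H x) \<le> L"
    by (metis compact_imp_bounded bounded_iff imageI)
  \<comment> \<open>\<open>L\<close> bounds each entry of the Hessian; passing to the operator norm
    costs a factor equal to the number of entries.\<close>
  define K where "K = real CARD('n) * real CARD('n) * L"
  have K: "onorm (\<lambda>h. H x *v h) \<le> K" if "x \<in> cball x0 R" for x
    unfolding K_def
  proof (rule onorm_le_matrix_component)
    fix i j
    have "\<bar>H x $ i $ j\<bar> \<le> norm (H x $ i)" by (rule component_le_norm_cart)
    also have "\<dots> \<le> norm (H x)" by (rule Finite_Cartesian_Product.norm_nth_le)
    also have "\<dots> \<le> L" using that by (rule L)
    finally show "\<bar>H x $ i $ j\<bar> \<le> L" .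
  qed
  have "0 \<le> L" using L[of x0] R norm_ge_zero[of "H x0"] by (simp del: norm_ge_zero)
  then have K0: "0 \<le> K" by (simp add: K_def)
  have lip: "norm (g y - g z) \<le> K * norm (y - z)" if "y \<in> cball x0 R" "z \<in> cball x0 R" for y z
    by (rule differentiable_bound[OF convex_cball _ K that])
       (use g R in \<open>blast intro: has_derivative_at_withinI\<close>)
  \<comment> \<open>Halving the radius keeps both points \<open>x + t *\<^sub>R \<xi>\<close> and
    \<open>x - t *\<^sub>R \<xi>\<close> inside \<open>cball x0 R\<close>, where the gradient has
    Lipschitz constant \<open>K\<close>.\<close>
  have main: "\<bar>second_diff u x (\<tau> *\<^sub>R \<xi>)\<bar> \<le> 2 * K * \<tau>\<^sup>2"
    if x: "x \<in> ball x0 (R/2)" and \<xi>: "norm \<xi> = 1" and \<tau>: "0 < \<tau>" "\<tau> < R/2" for x \<xi> \<tau>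
  proof -
    define \<phi> where "\<phi> t = u (x + t *\<^sub>R \<xi>) + u (x - t *\<^sub>R \<xi>)" for t
    have in_ball: "x + t *\<^sub>R \<xi> \<in> cball x0 R" "x - t *\<^sub>R \<xi> \<in> cball x0 R" if "t \<in> {0..\<tau>}" for t
    proof -
      have "norm (t *\<^sub>R \<xi>) \<le> R/2" using that \<tau> \<xi> by auto
      moreover have "dist x0 x < R/2" using x by simp
      moreover have "dist x (x + t *\<^sub>R \<xi>) = norm (t *\<^sub>R \<xi>)" "dist x (x - t *\<^sub>R \<xi>) = norm (t *\<^sub>R \<xi>)"
        by (simp_all add: dist_norm)
      ultimately show "x + t *\<^sub>R \<xi> \<in> cball x0 R" "x - t *\<^sub>R \<xi> \<in> cball x0 R"
        using dist_triangle[of x0 "x + t *\<^sub>R \<xi>" x] dist_triangle[of x0 "x - t *\<^sub>R \<xi>" x]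
        unfolding mem_cball by linarith+
    qed
    have deriv: "(\<phi> has_derivative (\<lambda>h. h * ((g (x + t *\<^sub>R \<xi>) - g (x - t *\<^sub>R \<xi>)) \<bullet> \<xi>)))
        (at t within {0..\<tau>})" if t: "t \<in> {0..\<tau>}" for t
    proof -
      have mem: "x + t *\<^sub>R \<xi> \<in> \<Omega>" "x - t *\<^sub>R \<xi> \<in> \<Omega>" using in_ball[OF t] R by auto
      have 1: "((\<lambda>t. x + t *\<^sub>R \<xi>) has_derivative (\<lambda>h. h *\<^sub>R \<xi>)) (at t within {0..\<tau>})"
        by (auto intro!: derivative_eq_intros)
      have 2: "((\<lambda>t. x - t *\<^sub>R \<xi>) has_derivative (\<lambda>h. - (h *\<^sub>R \<xi>))) (at t within {0..\<tau>})"
        by (auto intro!: derivative_eq_intros)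
      show ?thesis
        unfolding \<phi>_def
        by (rule has_derivative_eq_rhs
              [OF has_derivative_add[OF has_derivative_compose[OF 1 u[OF mem(1)]]
                  has_derivative_compose[OF 2 u[OF mem(2)]]]])
           (auto simp: algebra_simps inner_diff_left)
    qed
    \<comment> \<open>Since \<open>\<phi> 0 = 2 * u x\<close>, this increment is the second
      difference. The slope at \<open>t\<close> is at most \<open>2 * K * t\<close>, coarsened to
      \<open>2 * K * \<tau>\<close>.\<close>
    have "norm (\<phi> \<tau> - \<phi> 0) \<le> 2 * K * \<tau> * norm (\<tau> - 0)"
    proof (rule differentiable_bound[OF _ deriv])
      fix t assume t: "t \<in> {0..\<tau>}"
      have "\<bar>(g (x + t *\<^sub>R \<xi>) - g (x - t *\<^sub>R \<xi>)) \<bullet> \<xi>\<bar>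
          \<le> norm (g (x + t *\<^sub>R \<xi>) - g (x - t *\<^sub>R \<xi>)) * norm \<xi>"
        by (rule Cauchy_Schwarz_ineq2)
      also have "\<dots> \<le> K * norm ((x + t *\<^sub>R \<xi>) - (x - t *\<^sub>R \<xi>))"
        using lip[OF in_ball[OF t]] \<xi> by simp
      also have "(x + t *\<^sub>R \<xi>) - (x - t *\<^sub>R \<xi>) = (2 * t) *\<^sub>R \<xi>"
        by (simp add: scaleR_2[symmetric])
      also have "K * norm ((2 * t) *\<^sub>R \<xi>) \<le> 2 * K * \<tau>"
        using t \<xi> K0 by (simp add: mult_left_mono)
      finally have *: "\<bar>(g (x + t *\<^sub>R \<xi>) - g (x - t *\<^sub>R \<xi>)) \<bullet> \<xi>\<bar> \<le> 2 * K * \<tau>" .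
      show "onorm (\<lambda>h. h * ((g (x + t *\<^sub>R \<xi>) - g (x - t *\<^sub>R \<xi>)) \<bullet> \<xi>)) \<le> 2 * K * \<tau>"
        by (rule onorm_le) (use * in \<open>simp add: abs_mult mult.commute mult_left_mono\<close>)
    qed (use \<tau> in auto)
    then show ?thesis
      using \<tau> by (simp add: \<phi>_def second_diff_def power2_eq_square algebra_simps)
  qed
  show thesis
  proof (rule that)
    show "R/2 > 0" "2 * K \<ge> 0" using R K0 by auto
    show "ball x0 (R/2) \<subseteq> \<Omega>" using R by (auto simp: subset_iff)
  qed (use main in auto)
qed

text \<open>Extension by 0 to the whole line, so that the convergence lemma, whose pointwise
  hypotheses concern every real \<tau>, applies over \<open>lborel\<close>.\<close>

definition I_integrand :: "real \<Rightarrow> (real^'n \<Rightarrow> real) \<Rightarrow> real^'n \<Rightarrow> real^'n \<Rightarrow> real \<Rightarrow> real" where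
  "I_integrand s u x \<xi> \<tau> =
     indicator {0<..} \<tau> * (second_diff u x (\<tau> *\<^sub>R \<xi>) / \<tau> powr (1 + 2 * s))"

lemma I_dir_eq: "I_dir s \<xi> u x = frac_lap_const s * integral\<^sup>L lborel (I_integrand s u x \<xi>)"
  by (simp add: I_dir_def set_lebesgue_integral_def I_integrand_def[abs_def])

text \<open>Near 0 the quadratic bound leaves the exponent 1 - 2s, integrable because s < 1; far
  away boundedness of \<open>u\<close> leaves -1 - 2s, integrable because s > 0.\<close>

lemma I_integrand_dominated:
  fixes u :: "real^'n \<Rightarrow> real"
  assumes s: "0 < s" "s < 1" and "open \<Omega>" "C2_on \<Omega> u" "x0 \<in> \<Omega>" and "bounded (range u)"
  obtains r G where "r > 0" "ball x0 r \<subseteq> \<Omega>" "integrable lborel G"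
    "\<And>x \<xi> \<tau>. x \<in> ball x0 r \<Longrightarrow> norm \<xi> = 1 \<Longrightarrow> \<bar>I_integrand s u x \<xi> \<tau>\<bar> \<le> G \<tau>"
proof -
  obtain r K where r: "r > 0" and K0: "K \<ge> 0" and sub: "ball x0 r \<subseteq> \<Omega>"
    and K: "\<And>x \<xi> \<tau>. x \<in> ball x0 r \<Longrightarrow> norm \<xi> = 1 \<Longrightarrow> 0 < \<tau> \<Longrightarrow> \<tau> < r
       \<Longrightarrow> \<bar>second_diff u x (\<tau> *\<^sub>R \<xi>)\<bar> \<le> K * \<tau>\<^sup>2"
    using C2_on_second_diff_bound[OF assms(3-5)] by blast
  obtain B where B: "\<And>x. \<bar>u x\<bar> \<le> B"
    using assms(6) by (auto simp: bounded_iff)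
  then have B0: "B \<ge> 0" using abs_ge_zero order_trans by blast
  \<comment> \<open>The factor 4 counts the values of \<open>u\<close> in a second difference, with
    multiplicity. The ranges overlap at \<open>r\<close>, harmlessly since both terms are
    nonnegative.\<close>
  define G where "G \<tau> = K * (indicator {0..r} \<tau> * \<tau> powr (1 - 2 * s))
      + 4 * B * (indicator {r..} \<tau> * \<tau> powr (- 1 - 2 * s))" for \<tau>
  have "set_integrable lebesgue {0..r} (\<lambda>\<tau>. \<tau> powr (1 - 2 * s))"
    using s r by (intro nonnegative_absolutely_integrable_1 integrable_on_powr_from_0) auto
  moreover have "set_integrable lebesgue {r..} (\<lambda>\<tau>. \<tau> powr (- 1 - 2 * s))"
    using s r has_integral_powr_to_inf[of "- 1 - 2 * s" r]
    by (intro nonnegative_absolutely_integrable_1) (auto simp: has_integral_integrable)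
  \<comment> \<open>\<open>lebesgue\<close> is the completion of \<open>lborel\<close>, so
    integrability of these Borel functions transfers.\<close>
  ultimately have "integrable lborel (\<lambda>\<tau>. indicator {0..r} \<tau> * \<tau> powr (1 - 2 * s))"
    "integrable lborel (\<lambda>\<tau>. indicator {r..} \<tau> * \<tau> powr (- 1 - 2 * s))"
    by (simp_all add: set_integrable_def integrable_completion)
  then have G: "integrable lborel G"
    unfolding G_def[abs_def] by auto
  have "\<bar>I_integrand s u x \<xi> \<tau>\<bar> \<le> G \<tau>" if x: "x \<in> ball x0 r" and \<xi>: "norm \<xi> = 1" for x \<xi> \<tau>
  proof -
    consider "\<tau> \<le> 0" | "0 < \<tau>" "\<tau> < r" | "r \<le> \<tau>" by linarith
    then show ?thesis
    proof cases
      case 1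
      then show ?thesis using K0 B0 by (simp add: I_integrand_def G_def)
    next
      case 2
      have "\<bar>I_integrand s u x \<xi> \<tau>\<bar> = \<bar>second_diff u x (\<tau> *\<^sub>R \<xi>)\<bar> / \<tau> powr (1 + 2 * s)"
        using 2 by (simp add: I_integrand_def)
      also have "\<dots> \<le> K * \<tau>\<^sup>2 / \<tau> powr (1 + 2 * s)"
        using K[OF x \<xi> 2] by (intro divide_right_mono) auto
      also have "\<dots> = K * \<tau> powr (1 - 2 * s)"
      proof -
        have "\<tau> powr (1 - 2 * s) = \<tau> powr (2 - (1 + 2 * s))" by simp
        also have "\<dots> = \<tau>\<^sup>2 / \<tau> powr (1 + 2 * s)"
          using 2 by (subst powr_diff) simp
        finally show ?thesis by simp
      qed
      also have "\<dots> \<le> G \<tau>" using 2 B0 by (simp add: G_def)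
      finally show ?thesis .
    next
      case 3
      then have pos: "\<tau> > 0" using r by simp
      have "\<bar>I_integrand s u x \<xi> \<tau>\<bar> = \<bar>second_diff u x (\<tau> *\<^sub>R \<xi>)\<bar> / \<tau> powr (1 + 2 * s)"
        using pos by (simp add: I_integrand_def)
      also have "\<dots> \<le> 4 * B / \<tau> powr (1 + 2 * s)"
        using B[of "x + \<tau> *\<^sub>R \<xi>"] B[of "x - \<tau> *\<^sub>R \<xi>"] B[of x]
        by (intro divide_right_mono) (auto simp: second_diff_def)
      also have "\<dots> = 4 * B * \<tau> powr (- 1 - 2 * s)"
        using powr_minus_divide[of \<tau> "1 + 2 * s"] by simp
      also have "\<dots> \<le> G \<tau>" using 3 K0 by (simp add: G_def)
      finally show ?thesis .
    qed
  qed
  with r sub G show thesis by (intro that[of r G]) auto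
qed

text \<open>The integrand is nonnegative. For exponents where it is not integrable, the default
  integral 0 and \<open>inverse 0 = 0\<close> still give the claim.\<close>

lemma frac_lap_const_nonneg: "0 \<le> frac_lap_const s"
  unfolding frac_lap_const_def set_lebesgue_integral_def by (auto intro!: integral_nonneg)

section \<open>Semicontinuity and boundedness of the directional operator\<close>

text \<open>Measurability along a line comes from semicontinuity: it makes \<open>u\<close> Borel,
  and Borel functions compose with the affine maps parametrizing the line.\<close>

lemma lsc_on_I_integrand_borel_measurable:
  fixes u :: "real^'n \<Rightarrow> real"
  assumes "lsc_on UNIV u"
  shows "I_integrand s u x \<xi> \<in> borel_measurable borel"
proof -
  note [measurable] = lsc_on_UNIV_borel_measurable[OF assms]
  have [measurable]: "(\<lambda>\<tau>. x + \<tau> *\<^sub>R \<xi>) \<in> borel_measurable borel" "(\<lambda>\<tau>. x - \<tau> *\<^sub>R \<xi>) \<in> borel_measurable borel"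
    by (auto intro!: borel_measurable_continuous_onI continuous_intros)
  show ?thesis
    unfolding I_integrand_def[abs_def] second_diff_def by measurable
qed

lemma C2_on_imp_continuous_on:
  assumes "C2_on \<Omega> u"
  shows "continuous_on \<Omega> u"
  using assms unfolding C2_on_def
  by (meson continuous_at_imp_continuous_on has_derivative_continuous)

lemma lsc_on_I_dir:
  fixes u :: "real^'n \<Rightarrow> real"
  assumes s: "0 < s" "s < 1" and \<Omega>: "open \<Omega>" and C2: "C2_on \<Omega> u" and bdd: "bounded (range u)"
    and lsc: "lsc_on UNIV u"
  shows "lsc_on (\<Omega> \<times> sphere 0 1) (\<lambda>(x, \<xi>). I_dir s \<xi> u x)"
proof -
  have "lsc_on (\<Omega> \<times> sphere 0 1) (\<lambda>p. integral\<^sup>L lborel (I_integrand s u (fst p) (snd p)))"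
  proof (rule lsc_on_sequentially)
    fix p and P :: "nat \<Rightarrow> (real^'n) \<times> (real^'n)" and a
    assume p: "p \<in> \<Omega> \<times> sphere 0 1" and P: "\<And>n. P n \<in> \<Omega> \<times> sphere 0 1" and lim: "P \<longlonglongrightarrow> p"
      and a: "a < integral\<^sup>L lborel (I_integrand s u (fst p) (snd p))"
    obtain x \<xi> where p_eq: "p = (x, \<xi>)" by (cases p)
    define X where "X n = fst (P n)" for n
    define Y where "Y n = snd (P n)" for n
    have X: "X \<longlonglongrightarrow> x" "Y \<longlonglongrightarrow> \<xi>"
      using tendsto_fst[OF lim] tendsto_snd[OF lim] by (simp_all add: X_def[abs_def] Y_def[abs_def] p_eq)
    have mem: "x \<in> \<Omega>" "norm \<xi> = 1" "X n \<in> \<Omega>" "norm (Y n) = 1" for n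
      using p P[of n] by (auto simp: p_eq X_def Y_def mem_Times_iff)
    obtain r G where r: "r > 0" "ball x r \<subseteq> \<Omega>" and G: "integrable lborel G"
      and IG: "\<And>y \<eta> \<tau>. y \<in> ball x r \<Longrightarrow> norm \<eta> = 1 \<Longrightarrow> \<bar>I_integrand s u y \<eta> \<tau>\<bar> \<le> G \<tau>"
      using I_integrand_dominated[OF s \<Omega> C2 mem(1) bdd] by blast
    have "eventually (\<lambda>n. X n \<in> ball x r) sequentially"
      using X(1) r by (intro topological_tendstoD) auto
    \<comment> \<open>The majorant is valid only near \<open>x\<close>, while the convergence lemma
      wants it for all indices; hence the shift by \<open>m\<close>, undone at the end.\<close>
    then obtain m where m: "\<And>n. n \<ge> m \<Longrightarrow> X n \<in> ball x r"
      by (auto simp: eventually_sequentially)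
    have "eventually (\<lambda>n. a < integral\<^sup>L lborel (I_integrand s u (X (n + m)) (Y (n + m)))) sequentially"
    proof (rule integral_lsc_dominated[OF _ _ G])
      fix \<tau> b assume b: "b < I_integrand s u x \<xi> \<tau>"
      show "eventually (\<lambda>n. b < I_integrand s u (X (n + m)) (Y (n + m)) \<tau>) sequentially"
      proof (cases "\<tau> > 0")
        case False
        with b show ?thesis by (simp add: I_integrand_def)
      next
        case True
        have [simp]: "z / \<tau> powr (1 + 2 * s) > b \<longleftrightarrow> b * \<tau> powr (1 + 2 * s) < z" for z
          using True by (simp add: field_simps)
        \<comment> \<open>A quarter of the gap: one \<open>d\<close> is spent on each of the two
          translated values and two on the term \<open>- 2 * u x\<close>.\<close>
        define d where "d = (second_diff u x (\<tau> *\<^sub>R \<xi>) - b * \<tau> powr (1 + 2 * s)) / 4"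
        have d: "d > 0" using b True by (simp add: I_integrand_def d_def)
        have X': "(\<lambda>n. X (n + m)) \<longlonglongrightarrow> x" "(\<lambda>n. Y (n + m)) \<longlonglongrightarrow> \<xi>"
          using X by (simp_all add: LIMSEQ_ignore_initial_segment)
        have "eventually (\<lambda>n. u (x + \<tau> *\<^sub>R \<xi>) - d < u (X (n + m) + \<tau> *\<^sub>R Y (n + m))) sequentially"
          using d by (intro lsc_onD_filter[OF lsc, of "x + \<tau> *\<^sub>R \<xi>"] tendsto_intros X') auto
        moreover have "eventually (\<lambda>n. u (x - \<tau> *\<^sub>R \<xi>) - d < u (X (n + m) - \<tau> *\<^sub>R Y (n + m))) sequentially"
          using d by (intro lsc_onD_filter[OF lsc, of "x - \<tau> *\<^sub>R \<xi>"] tendsto_intros X') auto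
        \<comment> \<open>The central value enters with a negative sign, so an upper bound is
          required; it comes from continuity of \<open>u\<close> in \<Omega>.\<close>
        moreover have "(\<lambda>n. u (X (n + m))) \<longlonglongrightarrow> u x"
          by (rule continuous_on_tendsto_compose[OF C2_on_imp_continuous_on[OF C2] X'(1)])
             (use mem in auto)
        then have "eventually (\<lambda>n. u (X (n + m)) < u x + d) sequentially"
          using d by (intro order_tendstoD) auto
        ultimately show ?thesis
        proof eventually_elim
          case (elim n)
          then have "second_diff u x (\<tau> *\<^sub>R \<xi>) - 4 * d < second_diff u (X (n + m)) (\<tau> *\<^sub>R Y (n + m))"
            unfolding second_diff_def by linarith
          with True show ?case by (simp add: I_integrand_def d_def field_simps)
        qed
      qed
    qed (use lsc_on_I_integrand_borel_measurable[OF lsc] IG m mem a r in \<open>auto simp: p_eq\<close>)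
    then show "eventually (\<lambda>n. a < integral\<^sup>L lborel (I_integrand s u (fst (P n)) (snd (P n)))) sequentially"
      unfolding X_def[symmetric] Y_def[symmetric]
      by (rule eventually_sequentially_seg[THEN iffD1])
  qed
  from lsc_on_mult_left[OF this frac_lap_const_nonneg[of s]] show ?thesis
    by (simp add: I_dir_eq case_prod_unfold)
qed

text \<open>Integrating the majorant gives a bound uniform in \<xi>, which ensures that the real
  \<open>SUP\<close> and \<open>INF\<close> in \<open>I_plus\<close> and \<open>I_minus\<close> are
  taken over bounded families.\<close>

lemma I_dir_bounded:
  fixes u :: "real^'n \<Rightarrow> real"
  assumes s: "0 < s" "s < 1" and \<Omega>: "open \<Omega>" and C2: "C2_on \<Omega> u" and bdd: "bounded (range u)"
    and lsc: "lsc_on UNIV u" and x: "x \<in> \<Omega>"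
  obtains K where "\<And>\<xi>. norm \<xi> = 1 \<Longrightarrow> \<bar>I_dir s \<xi> u x\<bar> \<le> K"
proof -
  obtain r G where r: "r > 0" "ball x r \<subseteq> \<Omega>" and G: "integrable lborel G"
    and IG: "\<And>y \<xi> \<tau>. y \<in> ball x r \<Longrightarrow> norm \<xi> = 1 \<Longrightarrow> \<bar>I_integrand s u y \<xi> \<tau>\<bar> \<le> G \<tau>"
    using I_integrand_dominated[OF s \<Omega> C2 x bdd] by blast
  have "\<bar>I_dir s \<xi> u x\<bar> \<le> frac_lap_const s * integral\<^sup>L lborel G" if \<xi>: "norm \<xi> = 1" for \<xi>
  proof -
    have le: "\<bar>I_integrand s u x \<xi> \<tau>\<bar> \<le> G \<tau>" for \<tau> using IG r \<xi> by simp
    have "norm (integral\<^sup>L lborel (I_integrand s u x \<xi>)) \<le> integral\<^sup>L lborel G"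
    proof (rule Bochner_Integration.integral_norm_bound_integral[OF _ G])
      show "integrable lborel (I_integrand s u x \<xi>)"
        by (rule Bochner_Integration.integrable_bound[OF G])
           (auto intro: order_trans[OF le abs_ge_self]
             simp: lsc_on_I_integrand_borel_measurable[OF lsc])
    qed (simp add: le)
    then show ?thesis
      by (simp add: I_dir_eq abs_mult frac_lap_const_nonneg mult_left_mono)
  qed
  then show thesis by (rule that)
qed

section \<open>Orthonormal sets as a compact family of frames\<close>

lemma orthonormal_sets_nonempty:
  assumes "k \<le> CARD('n)"
  shows "(orthonormal_sets k :: (real^'n) set set) \<noteq> {}"
proof -
  obtain B where B: "B \<subseteq> (Basis :: (real^'n) set)" "card B = k"
    using obtain_subset_with_card_n[of k "Basis :: (real^'n) set"] assms by auto
  then have "B \<in> orthonormal_sets k"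
    by (auto simp: orthonormal_sets_def pairwise_def orthogonal_def subset_iff
        intro: finite_subset[OF _ finite_Basis] norm_Basis inner_not_same_Basis)
  then show ?thesis by blast
qed

text \<open>A \<open>k\<close>-frame is encoded as a square matrix whose rows indexed by \<open>J\<close>, with \<open>card J = k\<close>, form
  the frame; the remaining rows are set to \<open>0\<close> to make the set of all frames compact.\<close>

definition frames :: "'n set \<Rightarrow> (real^'n^'n) set" where
  "frames J = {A. (\<forall>i. if i \<in> J then norm (A $ i) = 1 else A $ i = 0) \<and>
                  (\<forall>i\<in>J. \<forall>j\<in>J. i \<noteq> j \<longrightarrow> A $ i \<bullet> A $ j = 0)}"

lemma compact_frames: "compact (frames J :: (real^'n^'n) set)"
proof -
  have "frames J = (\<Inter>i. {A :: real^'n^'n. if i \<in> J then norm (A $ i) = 1 else A $ i = 0}) \<inter>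
      (\<Inter>i\<in>J. \<Inter>j\<in>J. {A. i \<noteq> j \<longrightarrow> A $ i \<bullet> A $ j = 0})"
    by (auto simp: frames_def)
  moreover have "closed \<dots>"
  proof (intro closed_Int closed_INT ballI)
    fix i
    show "closed {A :: real^'n^'n. if i \<in> J then norm (A $ i) = 1 else A $ i = 0}"
      by (cases "i \<in> J") (auto intro!: closed_Collect_eq continuous_intros)
  next
    fix i j
    show "closed {A :: real^'n^'n. i \<noteq> j \<longrightarrow> A $ i \<bullet> A $ j = 0}"
      by (cases "i = j") (auto intro!: closed_Collect_eq continuous_intros)
  qed
  moreover have "bounded (frames J :: (real^'n^'n) set)"
  proof (rule boundedI)
    fix A :: "real^'n^'n" assume A: "A \<in> frames J"
    have "norm (A $ i) \<le> 1" for i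
      using A by (cases "i \<in> J") (auto simp: frames_def dest: spec[of _ i])
    moreover have "norm A \<le> (\<Sum>i\<in>UNIV. norm (A $ i))"
      by (subst norm_vec_def) (rule L2_set_le_sum, simp)
    ultimately show "norm A \<le> (\<Sum>i\<in>(UNIV::'n set). 1)"
      by (meson order_trans sum_mono)
  qed
  ultimately show ?thesis by (simp add: compact_eq_bounded_closed)
qed

text \<open>A sum over an orthonormal set does not depend on how it is enumerated. This moves
  extrema from a family of sets to a compact set of matrices.\<close>

lemma sum_orthonormal_sets_eq_frames:
  fixes f :: "real^'n \<Rightarrow> real"
  assumes J: "card J = k"
  shows "(\<lambda>B. sum f B) ` orthonormal_sets k = (\<lambda>A. \<Sum>i\<in>J. f (A $ i)) ` frames (J :: 'n set)"
proof (intro equalityI image_subsetI)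
  fix B :: "(real^'n) set" assume B: "B \<in> orthonormal_sets k"
  then have "finite B" "card B = card J"
    using J by (auto simp: orthonormal_sets_def)
  then obtain h where h: "bij_betw h J B"
    using finite_same_card_bij[of J B] by auto
  define A :: "real^'n^'n" where "A = (\<chi> i. if i \<in> J then h i else 0)"
  have A: "A $ i = (if i \<in> J then h i else 0)" for i by (simp add: A_def)
  have "A \<in> frames J"
    using B bij_betwE[OF h] bij_betw_imp_inj_on[OF h, THEN inj_on_contraD]
    by (simp add: frames_def A orthonormal_sets_def pairwise_def orthogonal_def)
  moreover have "sum f B = (\<Sum>i\<in>J. f (A $ i))"
    using sum.reindex_bij_betw[OF h, of f] by (simp add: A)
  ultimately show "sum f B \<in> (\<lambda>A. \<Sum>i\<in>J. f (A $ i)) ` frames J" by blast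
next
  fix A :: "real^'n^'n" assume A: "A \<in> frames J"
  then have norm: "\<And>i. i \<in> J \<Longrightarrow> norm (A $ i) = 1"
    and orth: "\<And>i j. i \<in> J \<Longrightarrow> j \<in> J \<Longrightarrow> i \<noteq> j \<Longrightarrow> A $ i \<bullet> A $ j = 0"
    by (auto simp: frames_def)
  \<comment> \<open>Two equal rows with different indices would be a unit vector orthogonal to
    itself. Injectivity yields both the cardinality \<open>k\<close> and the reindexing of the
    sum.\<close>
  have inj: "inj_on (($) A) J"
  proof (rule inj_onI, rule ccontr)
    fix i j assume "i \<in> J" "j \<in> J" "A $ i = A $ j" "i \<noteq> j"
    then show False using norm[of i] orth[of i j] by auto
  qed
  have "($) A ` J \<in> orthonormal_sets k"
    using norm orth J card_image[OF inj]
    by (auto simp: orthonormal_sets_def pairwise_def orthogonal_def)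
  moreover have "sum f (($) A ` J) = (\<Sum>i\<in>J. f (A $ i))"
    using inj by (simp add: sum.reindex)
  ultimately show "(\<Sum>i\<in>J. f (A $ i)) \<in> (\<lambda>B. sum f B) ` orthonormal_sets k"
    by (metis imageI)
qed

section \<open>Infima and suprema of semicontinuous families\<close>

text \<open>If the claim fails at \<open>x\<close>, there are points tending to \<open>x\<close>
  with parameters in \<open>K\<close> at which \<open>F\<close> stays too small; compactness makes
  the parameters converge along a subsequence, against joint semicontinuity at the limit.\<close>

lemma lsc_on_INF_compact:
  fixes F :: "'a::metric_space \<times> 'b::metric_space \<Rightarrow> real"
  assumes F: "lsc_on (S \<times> K) F" and K: "compact K" "K \<noteq> {}"
    and bdd: "\<And>x. x \<in> S \<Longrightarrow> bdd_below ((\<lambda>y. F (x, y)) ` K)"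
  shows "lsc_on S (\<lambda>x. INF y\<in>K. F (x, y))"
proof (rule ccontr)
  assume "\<not> ?thesis"
  then obtain x a where x: "x \<in> S" and a: "a < (INF y\<in>K. F (x, y))"
    and ne: "\<not> eventually (\<lambda>z. a < (INF y\<in>K. F (z, y))) (at x within S)"
    unfolding lsc_on_def by blast
  \<comment> \<open>The room above \<open>a\<close> turns an infimum that is at most
    \<open>a\<close> into an actual value below \<open>b\<close>, even if the infimum is not
    attained.\<close>
  obtain b where b: "a < b" "b < (INF y\<in>K. F (x, y))"
    using a dense by blast
  have "\<exists>z y. z \<in> S \<and> y \<in> K \<and> dist z x < inverse (real (Suc n)) \<and> F (z, y) < b" for n
  proof -
    have "inverse (real (Suc n)) > 0" by simp
    with ne obtain z where z: "z \<in> S" "dist z x < inverse (real (Suc n))" "(INF y\<in>K. F (z, y)) \<le> a"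
      unfolding eventually_at by (meson not_le)
    then have "(INF y\<in>K. F (z, y)) < b" using b by simp
    then obtain y where "y \<in> K" "F (z, y) < b"
      using K(2) bdd[OF z(1)] by (subst (asm) cINF_less_iff) auto
    with z show ?thesis by blast
  qed
  then obtain X Y where XY: "\<And>n. X n \<in> S" "\<And>n. Y n \<in> K"
    "\<And>n. dist (X n) x < inverse (real (Suc n))" "\<And>n. F (X n, Y n) < b"
    by metis
  have X: "X \<longlonglongrightarrow> x"
    unfolding tendsto_dist_iff[of X]
    by (rule tendsto_sandwich[OF _ _ tendsto_const LIMSEQ_inverse_real_of_nat])
       (use XY(3) in \<open>auto intro!: always_eventually less_imp_le\<close>)
  obtain y r where y: "y \<in> K" "strict_mono (r :: nat \<Rightarrow> nat)" "(Y \<circ> r) \<longlonglongrightarrow> y"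
    using K(1) XY(2) unfolding compact_def by metis
  have "(X \<circ> r) \<longlonglongrightarrow> x" using X y(2) by (rule LIMSEQ_subseq_LIMSEQ)
  then have "(\<lambda>n. (X (r n), Y (r n))) \<longlonglongrightarrow> (x, y)"
    using y(3) by (auto intro!: tendsto_Pair simp: o_def)
  moreover have "b < F (x, y)"
    using b(2) cINF_lower[OF bdd[OF x] y(1)] by simp
  ultimately have "eventually (\<lambda>n. b < F (X (r n), Y (r n))) sequentially"
    using x y(1) XY(1,2) by (intro lsc_onD_filter[OF F]) auto
  then obtain n where "b < F (X (r n), Y (r n))"
    by (auto simp: eventually_sequentially)
  with XY(4)[of "r n"] show False by simp
qed

text \<open>A single index exceeding \<open>a\<close> at \<open>x\<close> does so nearby, and the
  supremum dominates it.\<close>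

lemma lsc_on_SUP:
  fixes F :: "'i \<Rightarrow> 'a::topological_space \<Rightarrow> real"
  assumes F: "\<And>i. i \<in> I \<Longrightarrow> lsc_on S (F i)" and I: "I \<noteq> {}"
    and bdd: "\<And>x. x \<in> S \<Longrightarrow> bdd_above ((\<lambda>i. F i x) ` I)"
  shows "lsc_on S (\<lambda>x. SUP i\<in>I. F i x)"
  unfolding lsc_on_def
proof (intro ballI allI impI)
  fix x a assume x: "x \<in> S" and "a < (SUP i\<in>I. F i x)"
  then obtain i where i: "i \<in> I" "a < F i x"
    using less_cSUP_iff[OF I bdd] by blast
  then have "eventually (\<lambda>y. a < F i y) (at x within S)"
    using F x unfolding lsc_on_def by blast
  \<comment> \<open>Families are known to be bounded above only at points of \<open>S\<close>;
    elsewhere the real \<open>SUP\<close> need not dominate its members.\<close>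
  moreover have "eventually (\<lambda>y. y \<in> S) (at x within S)"
    by (simp add: eventually_at_filter)
  ultimately show "eventually (\<lambda>y. a < (SUP i\<in>I. F i y)) (at x within S)"
    by eventually_elim (use less_le_trans[OF _ cSUP_upper[OF i(1) bdd]] in blast)
qed

section \<open>Lower semicontinuity of the extremal operators\<close>

lemma I_dir_sum_bounded:
  fixes u :: "real^'n \<Rightarrow> real"
  assumes "0 < s" "s < 1" "open \<Omega>" "C2_on \<Omega> u" "bounded (range u)" "lsc_on UNIV u" "x \<in> \<Omega>"
  shows "bounded ((\<lambda>B. \<Sum>\<xi>\<in>B. I_dir s \<xi> u x) ` orthonormal_sets k)"
proof -
  obtain K where K: "\<And>\<xi>. norm \<xi> = 1 \<Longrightarrow> \<bar>I_dir s \<xi> u x\<bar> \<le> K"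
    using I_dir_bounded[OF assms] by blast
  have "\<bar>\<Sum>\<xi>\<in>B. I_dir s \<xi> u x\<bar> \<le> real k * K" if "B \<in> orthonormal_sets k" for B
    using that K
    by (auto simp: orthonormal_sets_def intro!: order_trans[OF sum_abs] sum_bounded_above)
  then show ?thesis by (intro boundedI[where B = "real k * K"]) auto
qed

lemma lsc_on_I_plus:
  fixes u :: "real^'n \<Rightarrow> real"
  assumes s: "0 < s" "s < 1" and \<Omega>: "open \<Omega>" and C2: "C2_on \<Omega> u" and bdd: "bounded (range u)"
    and lsc: "lsc_on UNIV u" and k: "k \<le> CARD('n)"
  shows "lsc_on \<Omega> (I_plus k s u)"
  unfolding I_plus_def[abs_def]
proof (intro lsc_on_SUP lsc_on_sum orthonormal_sets_nonempty k)
  fix B and \<xi> :: "real^'n" assume "B \<in> orthonormal_sets k" "\<xi> \<in> B"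
  then have "norm \<xi> = 1" by (auto simp: orthonormal_sets_def)
  then show "lsc_on \<Omega> (I_dir s \<xi> u)"
    \<comment> \<open>Restriction of joint semicontinuity to the slice with \<xi> fixed.\<close>
    using lsc_on_compose[OF lsc_on_I_dir[OF s \<Omega> C2 bdd lsc], of \<Omega> "\<lambda>x. (x, \<xi>)"]
    by (auto simp: continuous_on_Pair image_subset_iff)
qed (rule bounded_imp_bdd_above[OF I_dir_sum_bounded[OF s \<Omega> C2 bdd lsc]])

text \<open>Unlike the supremum, the infimum uses semicontinuity jointly in the point and the
  frame.\<close>

lemma lsc_on_I_minus:
  fixes u :: "real^'n \<Rightarrow> real"
  assumes s: "0 < s" "s < 1" and \<Omega>: "open \<Omega>" and C2: "C2_on \<Omega> u" and bdd: "bounded (range u)"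
    and lsc: "lsc_on UNIV u" and k: "k \<le> CARD('n)"
  shows "lsc_on \<Omega> (I_minus k s u)"
proof -
  obtain J :: "'n set" where J: "card J = k"
    using obtain_subset_with_card_n[OF k] by blast
  define F where "F p = (\<Sum>i\<in>J. I_dir s (snd p $ i) u (fst p))" for p :: "(real^'n) \<times> (real^'n^'n)"
  have img: "(\<lambda>B. \<Sum>\<xi>\<in>B. I_dir s \<xi> u x) ` orthonormal_sets k = (\<lambda>A. F (x, A)) ` frames J" for x
    using sum_orthonormal_sets_eq_frames[OF J, of "\<lambda>\<xi>. I_dir s \<xi> u x"] by (simp add: F_def)
  have "lsc_on \<Omega> (\<lambda>x. INF A\<in>frames J. F (x, A))"
  proof (rule lsc_on_INF_compact)
    show "lsc_on (\<Omega> \<times> frames J) F"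
      unfolding F_def[abs_def]
    proof (rule lsc_on_sum)
      fix i assume i: "i \<in> J"
      have "(\<lambda>p. (fst p, snd p $ i)) ` (\<Omega> \<times> frames J) \<subseteq> \<Omega> \<times> sphere 0 1"
        using i by (auto simp: frames_def)
      moreover have "continuous_on (\<Omega> \<times> frames J) (\<lambda>p. (fst p, snd p $ i))"
        by (intro continuous_intros)
      ultimately show "lsc_on (\<Omega> \<times> frames J) (\<lambda>p. I_dir s (snd p $ i) u (fst p))"
        using lsc_on_compose[OF lsc_on_I_dir[OF s \<Omega> C2 bdd lsc], of "\<Omega> \<times> frames J" "\<lambda>p. (fst p, snd p $ i)"]
        by simp
    qed
    show "compact (frames J)" by (rule compact_frames)
    show "frames J \<noteq> {}"
      \<comment> \<open>\<open>img\<close> holds at every point, in \<Omega> or not, so 0 serves to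
        transfer nonemptiness.\<close>
      using img[of 0] orthonormal_sets_nonempty[OF k] by auto
    show "bdd_below ((\<lambda>A. F (x, A)) ` frames J)" if "x \<in> \<Omega>" for x
      using I_dir_sum_bounded[OF s \<Omega> C2 bdd lsc that, of k] bounded_imp_bdd_below img by metis
  qed
  then show ?thesis by (simp add: I_minus_def[abs_def] img)
qed

section \<open>Reflection \<open>- u\<close> and conclusion\<close>

text \<open>An identity for every \<open>u\<close>: where the integral diverges, both sides take the
  default value 0.\<close>

lemma I_dir_minus: "I_dir s \<xi> (\<lambda>x. - u x) x = - I_dir s \<xi> u x"
proof -
  have "I_integrand s (\<lambda>x. - u x) x \<xi> = (\<lambda>\<tau>. - I_integrand s u x \<xi> \<tau>)"
    by (auto simp: I_integrand_def second_diff_def fun_eq_iff diff_divide_distrib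
        add_divide_distrib algebra_simps)
  then show ?thesis by (simp add: I_dir_eq)
qed

text \<open>The real \<open>Inf\<close> is defined as minus the \<open>Sup\<close> of the negated
  set, so the exchange is exact for any family.\<close>

lemma I_minus_minus: "I_minus k s (\<lambda>x. - u x) x = - I_plus k s u x"
  by (simp add: I_minus_def I_plus_def I_dir_minus sum_negf Inf_real_def image_image)

lemma I_plus_minus: "I_plus k s (\<lambda>x. - u x) x = - I_minus k s u x"
  by (simp add: I_minus_def I_plus_def I_dir_minus sum_negf Inf_real_def image_image)

lemma C2_on_minus:
  assumes "C2_on \<Omega> u"
  shows "C2_on \<Omega> (\<lambda>x. - u x)"
proof -
  obtain g H where *: "\<forall>x\<in>\<Omega>. (u has_derivative (\<lambda>h. g x \<bullet> h)) (at x)"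
    "\<forall>x\<in>\<Omega>. (g has_derivative (\<lambda>h. H x *v h)) (at x)" "continuous_on \<Omega> H"
    using assms unfolding C2_on_def by blast
  show ?thesis
    unfolding C2_on_def
  proof (intro exI[of _ "\<lambda>x. - g x"] exI[of _ "\<lambda>x. - H x"] conjI ballI)
    fix x assume x: "x \<in> \<Omega>"
    show "((\<lambda>x. - u x) has_derivative (\<lambda>h. - g x \<bullet> h)) (at x)"
      using has_derivative_minus[OF *(1)[rule_format, OF x]] by simp
    have "- H x *v h = - (H x *v h)" for h
      by (simp add: vec_eq_iff matrix_vector_mult_def sum_negf)
    then show "((\<lambda>x. - g x) has_derivative (\<lambda>h. - H x *v h)) (at x)"
      using has_derivative_minus[OF *(2)[rule_format, OF x]] by simp
  qed (use *(3) in \<open>auto intro: continuous_intros\<close>)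
qed

theorem proposition3p1:
  fixes s :: real and k :: nat
    and \<Omega> :: "(real^'n) set" and u :: "real^'n \<Rightarrow> real"
  assumes "0 < s" and "s < 1"
    and "open \<Omega>" and "connected \<Omega>" and "\<Omega> \<noteq> {}" and "bounded \<Omega>"
    and "k \<in> {1..CARD('n)}"
    and "C2_on \<Omega> u" and "bounded_measurable u"
  shows "(lsc_on UNIV u \<longrightarrow>
            lsc_on (\<Omega> \<times> sphere 0 1) (\<lambda>(x, \<xi>). I_dir s \<xi> u x) \<and>
            lsc_on \<Omega> (I_plus k s u) \<and> lsc_on \<Omega> (I_minus k s u)) \<and>
         (usc_on UNIV u \<longrightarrow>
            usc_on (\<Omega> \<times> sphere 0 1) (\<lambda>(x, \<xi>). I_dir s \<xi> u x) \<and>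
            usc_on \<Omega> (I_plus k s u) \<and> usc_on \<Omega> (I_minus k s u)) \<and>
         (continuous_on UNIV u \<longrightarrow>
            continuous_on (\<Omega> \<times> sphere 0 1) (\<lambda>(x, \<xi>). I_dir s \<xi> u x) \<and>
            continuous_on \<Omega> (I_plus k s u) \<and> continuous_on \<Omega> (I_minus k s u))"
proof -
  \<comment> \<open>Stated for a general \<open>v\<close>, to be used with both \<open>u\<close> and
    \<open>- u\<close>.\<close>
  have lsc: "lsc_on (\<Omega> \<times> sphere 0 1) (\<lambda>(x, \<xi>). I_dir s \<xi> v x) \<and>
      lsc_on \<Omega> (I_plus k s v) \<and> lsc_on \<Omega> (I_minus k s v)"
    if "C2_on \<Omega> v" "bounded (range v)" "lsc_on UNIV v" for v
    using that assms by (simp add: lsc_on_I_dir lsc_on_I_plus lsc_on_I_minus)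
  have bdd: "bounded (range u)" "bounded (range (\<lambda>x. - u x))"
    using assms(9) by (auto simp: bounded_measurable_def bounded_iff)
  have usc: "usc_on (\<Omega> \<times> sphere 0 1) (\<lambda>(x, \<xi>). I_dir s \<xi> u x) \<and>
      usc_on \<Omega> (I_plus k s u) \<and> usc_on \<Omega> (I_minus k s u)" if "usc_on UNIV u"
    using lsc[OF C2_on_minus[OF assms(8)] bdd(2)] that
    by (simp add: usc_on_iff_lsc_on_minus I_dir_minus I_minus_minus[abs_def] I_plus_minus[abs_def]
        case_prod_unfold)
  show ?thesis
    using lsc[OF assms(8) bdd(1)] usc by (simp add: continuous_on_iff_lsc_on_usc_on)
qed

end
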